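(* Let $n\ge1$, $p\in[1,\infty]$, $q\in(0,\infty)$, and let $\phi_1,\dots,\phi_n\in\mathcal{B}$ satisfy $\min\{\underline{b}(\phi_1),\dots,\underline{b}(\phi_n)\}>0$ and $\max\{\overline{b}(\phi_1),\dots,\overline{b}(\phi_n)\}<1$. Let $\mathbf{A}=(A_0,\dots,A_n)$ be an $(n+1)$-tuple of Banach spaces, each linearly and continuously embedded in a common Hausdorff topological vector space. Then $$K^{\phi_1,\dots,\phi_n}_p(\mathbf{A}^{(q)})=\Big(K^{(\phi_1)_q,\dots,(\phi_n)_q}_{pq}(\mathbf{A})\Big)^{(q)},$$ where $(\phi_j)_q(t)=\phi_j(t^q)^{1/q}$ for $t>0$; that is, the two sets coincide and the functionals defining them are equivalent up to multiplicative constants.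
   Context: **Boyd functions.** $\mathcal{B}$ is the set of continuous functions $\phi:(0,\infty)\to(0,\infty)$ with $\phi(1)=1$ and $\bar\phi(t)=\sup_{s>0}\phi(ts)/\phi(s)<\infty$ for every $t>0$; its Boyd indices are $\underline{b}(\phi)=\lim_{t\to0^+}\log\bar\phi(t)/\log t$ and $\overline{b}(\phi)=\lim_{t\to\infty}\log\bar\phi(t)/\log t$. **Powers of spaces.** If $A$ is a space equipped with a (quasi-)norm $\|\cdot\|_A$ and $\alpha>0$, $A^{(\alpha)}$ denotes the same space equipped with the functional $\|\cdot\|_A^\alpha$ (which is again called a quasi-norm, although it is not homogeneous of degree one in general). For $\mathbf{A}=(A_0,\dots,A_n)$, $\mathbf{A}^{(q)}=(A_0^{(q)},\dots,A_n^{(q)})$. **$K$-spaces.** For $\mathbf{A}$ a tuple of such spaces, $a\in\Sigma(\mathbf{A})=A_0+\dots+A_n$ and $t\in(0,\infty)^{n+1}$, $K(t,a)=\inf\{t_0\|a_0\|_{A_0}+\dots+t_n\|a_n\|_{A_n}\}$, the infimum being over all $a=a_0+\dots+a_n$ with $a_j\in A_j$, where $\|\cdot\|_{A_j}$ stands for the functional with which the $j$-th space is equipped (so $\|\cdot\|_{A_j}^q$ for $\mathbf{A}^{(q)}$). For $r\in(0,\infty]$, $K_r^{\phi_1,\dots,\phi_n}(\mathbf{A})$ is the set of $a\in\Sigma(\mathbf{A})$ for which $$\|a\|_{K_r^{\phi_1,\dots,\phi_n}(\mathbf{A})}=\Big(\int_{(0,\infty)^n}\Big(\frac{K(1,t_1,\dots,t_n,a)}{\phi_1(t_1)\cdots\phi_n(t_n)}\Big)^r\frac{dt_1}{t_1}\cdots\frac{dt_n}{t_n}\Big)^{1/r}<\infty$$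 (supremum if $r=\infty$). If $p=\infty$, then $pq=\infty$. *)

theory Defs
  imports "HOL-Analysis.Analysis"
begin

section \<open>Boyd functions\<close>

text \<open>Functions on the open half-line are rendered as functions on the reals of which only the
  values at positive arguments matter.\<close>

definition boyd_bar :: "(real \<Rightarrow> real) \<Rightarrow> real \<Rightarrow> real" where
  "boyd_bar \<phi> t = (SUP s\<in>{0<..}. \<phi> (t * s) / \<phi> s)"

definition boyd_functions :: "(real \<Rightarrow> real) set" where
  "boyd_functions = {\<phi>. continuous_on {0<..} \<phi> \<and> (\<forall>t>0. \<phi> t > 0) \<and> \<phi> 1 = 1 \<and>
     (\<forall>t>0. bdd_above ((\<lambda>s. \<phi> (t * s) / \<phi> s) ` {0<..}))}"

definition lower_boyd_index :: "(real \<Rightarrow> real) \<Rightarrow> real" where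
  "lower_boyd_index \<phi> = Lim (at_right 0) (\<lambda>t. ln (boyd_bar \<phi> t) / ln t)"

definition upper_boyd_index :: "(real \<Rightarrow> real) \<Rightarrow> real" where
  "upper_boyd_index \<phi> = Lim at_top (\<lambda>t. ln (boyd_bar \<phi> t) / ln t)"

definition boyd_power :: "real \<Rightarrow> (real \<Rightarrow> real) \<Rightarrow> real \<Rightarrow> real" where
  "boyd_power q \<phi> t = \<phi> (t powr q) powr (1 / q)"

section \<open>Spaces inside a topological vector space\<close>

text \<open>Scalars are real. A complex space is in particular a real one, with the same norm, and the
  \<open>K\<close>-functional involves only addition and norms, so the complex case is included.\<close>

class topological_real_vector = real_vector + topological_ab_group_add +
  assumes tendsto_scaleR_Pair:
    "LIM z (nhds (c::real) \<times>\<^sub>F nhds x). fst z *\<^sub>R snd z :> nhds (c *\<^sub>R x)"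

text \<open>A space equipped with a functional: the underlying set together with a function of which
  only the values on that set matter.\<close>

type_synonym 'v fspace = "'v set \<times> ('v \<Rightarrow> real)"

definition banach_subspace :: "('v::topological_real_vector) fspace \<Rightarrow> bool" where
  "banach_subspace X \<longleftrightarrow> (\<exists>S N. X = (S, N) \<and>
     subspace S \<and>
     (\<forall>x\<in>S. 0 \<le> N x) \<and>
     (\<forall>x\<in>S. N x = 0 \<longleftrightarrow> x = 0) \<and>
     (\<forall>c. \<forall>x\<in>S. N (c *\<^sub>R x) = \<bar>c\<bar> * N x) \<and>
     (\<forall>x\<in>S. \<forall>y\<in>S. N (x + y) \<le> N x + N y) \<and>
     \<comment> \<open>completeness\<close>
     (\<forall>u::nat \<Rightarrow> 'v. (\<forall>k. u k \<in> S) \<and> (\<forall>e>0. \<exists>M. \<forall>k\<ge>M. \<forall>l\<ge>M. N (u k - u l) < e) \<longrightarrow>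
        (\<exists>x\<in>S. (\<lambda>k. N (u k - x)) \<longlonglongrightarrow> 0)) \<and>
     \<comment> \<open>continuity of the inclusion map into the ambient space\<close>
     (\<forall>x\<in>S. \<forall>U. open U \<and> x \<in> U \<longrightarrow> (\<exists>d>0. \<forall>y\<in>S. N (y - x) < d \<longrightarrow> y \<in> U)))"

definition space_power :: "real \<Rightarrow> 'v fspace \<Rightarrow> 'v fspace" where
  "space_power \<alpha> X = (fst X, \<lambda>x. snd X x powr \<alpha>)"

definition fspace_equivalent :: "'v fspace \<Rightarrow> 'v fspace \<Rightarrow> bool" where
  "fspace_equivalent X Y \<longleftrightarrow> fst X = fst Y \<and>
     (\<exists>c>0. \<exists>C>0. \<forall>a\<in>fst X. c * snd X a \<le> snd Y a \<and> snd Y a \<le> C * snd X a)"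

section \<open>\<open>K\<close>-spaces\<close>

text \<open>A tuple \<open>(A\<^sub>0, \<dots>, A\<^sub>n)\<close> is a function on the naturals used only at the indices \<open>0, \<dots>, n\<close>.\<close>

definition decompositions :: "nat \<Rightarrow> (nat \<Rightarrow> ('v::comm_monoid_add) fspace) \<Rightarrow> 'v \<Rightarrow> (nat \<Rightarrow> 'v) set" where
  "decompositions n A a = {b. (\<forall>j\<le>n. b j \<in> fst (A j)) \<and> a = (\<Sum>j\<le>n. b j)}"

definition sum_space :: "nat \<Rightarrow> (nat \<Rightarrow> ('v::comm_monoid_add) fspace) \<Rightarrow> 'v set" where
  "sum_space n A = {a. decompositions n A a \<noteq> {}}"

definition K_functional ::
  "nat \<Rightarrow> (nat \<Rightarrow> ('v::comm_monoid_add) fspace) \<Rightarrow> (nat \<Rightarrow> real) \<Rightarrow> 'v \<Rightarrow> real" where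
  "K_functional n A t a = (INF b\<in>decompositions n A a. \<Sum>j\<le>n. t j * snd (A j) (b j))"

text \<open>The quotient \<open>K(1, t\<^sub>1, \<dots>, t\<^sub>n, a) / (\<phi>\<^sub>1(t\<^sub>1) \<cdots> \<phi>\<^sub>n(t\<^sub>n))\<close>. The parameter \<open>t\<close> is a function on
  the index set \<open>{1..n}\<close>; the update at \<open>0\<close> supplies the leading \<open>1\<close>.\<close>

definition K_quotient ::
  "nat \<Rightarrow> (nat \<Rightarrow> real \<Rightarrow> real) \<Rightarrow> (nat \<Rightarrow> ('v::comm_monoid_add) fspace) \<Rightarrow> 'v \<Rightarrow> (nat \<Rightarrow> real) \<Rightarrow> real" where
  "K_quotient n \<phi> A a t = K_functional n A (t(0 := 1)) a / (\<Prod>j=1..n. \<phi> j (t j))"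

abbreviation pos_orthant :: "nat \<Rightarrow> (nat \<Rightarrow> real) set" where
  "pos_orthant n \<equiv> PiE {1..n} (\<lambda>_. {0<..})"

text \<open>Real powers of extended nonnegative reals, for positive exponents.\<close>

definition ennreal_powr :: "ennreal \<Rightarrow> real \<Rightarrow> ennreal" where
  "ennreal_powr x \<alpha> = (if x = \<infinity> then \<infinity> else ennreal (enn2real x powr \<alpha>))"

definition K_norm ::
  "nat \<Rightarrow> (nat \<Rightarrow> real \<Rightarrow> real) \<Rightarrow> ennreal \<Rightarrow> (nat \<Rightarrow> ('v::comm_monoid_add) fspace) \<Rightarrow> 'v \<Rightarrow> ennreal" where
  "K_norm n \<phi> r A a =
     (if r = \<infinity> then (SUP t\<in>pos_orthant n. ennreal (K_quotient n \<phi> A a t))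
      else ennreal_powr
        (\<integral>\<^sup>+ t \<in> pos_orthant n.
            ennreal (K_quotient n \<phi> A a t powr enn2real r / (\<Prod>j=1..n. t j))
          \<partial>(Pi\<^sub>M {1..n} (\<lambda>_. lborel)))
        (1 / enn2real r))"

definition K_space ::
  "nat \<Rightarrow> (nat \<Rightarrow> real \<Rightarrow> real) \<Rightarrow> ennreal \<Rightarrow> (nat \<Rightarrow> ('v::comm_monoid_add) fspace) \<Rightarrow> 'v fspace" where
  "K_space n \<phi> r A =
     ({a \<in> sum_space n A. K_norm n \<phi> r A a < \<infinity>}, \<lambda>a. enn2real (K_norm n \<phi> r A a))"

end

theory Submission
  imports Defs
begin

text \<open>For nonnegative \<open>x\<^sub>0, \<dots>, x\<^sub>n\<close> the quantities \<open>(x\<^sub>0 + \<dots> + x\<^sub>n)\<^sup>q\<close> and \<open>x\<^sub>0\<^sup>q + \<dots> + x\<^sub>n\<^sup>q\<close> agree up to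
  constants depending only on \<open>n\<close> and \<open>q\<close>. Taking infima over decompositions, the \<open>K\<close>-functional of
  the powered tuple at \<open>(s\<^sub>j\<^sup>q)\<close> is comparable to the \<open>q\<close>-th power of the \<open>K\<close>-functional of the original
  tuple at \<open>(s\<^sub>j)\<close>. The substitution \<open>t\<^sub>j = s\<^sub>j\<^sup>q\<close>, which multiplies the Haar measure \<open>dt/t\<close> by \<open>q\<^sup>n\<close>,
  then identifies the two norms up to constants.\<close>

section \<open>The substitution \<open>t = s powr q\<close> for the measure dt/t, on the half-line
  and on products\<close>

text \<open>Continuity from below of the measure with density \<open>F\<close>. It carries a
  substitution done on compact intervals over to the half-line.\<close>

lemma nn_integral_SUP_incseq_sets:
  assumes "F \<in> borel_measurable M" "incseq B" "\<And>k::nat. B k \<in> sets M"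
  shows "(\<integral>\<^sup>+x\<in>(\<Union>k. B k). F x \<partial>M) = (SUP k. \<integral>\<^sup>+x\<in>B k. F x \<partial>M)"
proof -
  have "(SUP k. emeasure (density M F) (B k)) = emeasure (density M F) (\<Union>k. B k)"
    using assms by (intro SUP_emeasure_incseq) auto
  then show ?thesis
    using assms by (simp add: emeasure_density sets.countable_UN)
qed

text \<open>The factor \<open>q\<close> is the Jacobian: x = y^q gives dx/x = q dy/y. Near 0 the
  derivative of the power may blow up, so the substitution is made on compact intervals
  \<open>{l k..u k}\<close> inside the open half-line; these intervals and their images under the
  power both exhaust it.\<close>

lemma nn_integral_powr_substitution:
  fixes h :: "real \<Rightarrow> ennreal" and q :: real
  assumes [measurable]: "h \<in> borel_measurable borel" and "0 < q"
  shows "(\<integral>\<^sup>+x\<in>{0<..}. h x * ennreal (1 / x) \<partial>lborel) =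
         ennreal q * (\<integral>\<^sup>+y\<in>{0<..}. h (y powr q) * ennreal (1 / y) \<partial>lborel)"
proof -
  \<comment> \<open>The shift by 2 keeps \<open>l k < 1 < u k\<close> even at \<open>k = 0\<close>,
    so no interval degenerates.\<close>
  define l u :: "nat \<Rightarrow> real" where "l k = 1 / real (k + 2)" and "u k = real (k + 2)" for k
  have l: "0 < l k" "l k < u k" "0 < u k" for k
  proof -
    have "1 / real (k + 2) < 1" by simp
    then show "l k < u k" unfolding l_def u_def by linarith
  qed (auto simp: l_def u_def)
  have lu: "\<exists>k. l k \<le> x \<and> x \<le> u k" if "0 < x" for x
  proof -
    \<comment> \<open>A bound on \<open>x + 1 / x\<close> controls both endpoints at once:
      \<open>x \<le> u k\<close>, and \<open>1 / x \<le> u k\<close> means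
      \<open>l k \<le> x\<close>.\<close>
    obtain k :: nat where k: "x + 1 / x \<le> real k" using real_arch_simple by blast
    have "0 < 1 / x" using that by simp
    then have "x \<le> real (k + 2)" "1 / x \<le> real (k + 2)" using k that by linarith+
    then show ?thesis unfolding l_def u_def using that by (intro exI[of _ k]) (simp add: field_simps)
  qed
  have mono: "l k' \<le> l k" "u k \<le> u k'" if "k \<le> k'" for k k'
    using that by (auto simp: l_def u_def frac_le)
  have B1: "(\<Union>k. {l k..u k}) = {0<..}"
    using lu less_le_trans[OF l(1)] by auto
  have B2: "(\<Union>k. {l k powr q..u k powr q}) = {0<..}"
  proof (intro equalityI subsetI)
    fix x :: real assume "x \<in> {0<..}"
    then have x: "0 < x" by simp
    obtain k where k: "l k \<le> x powr (1 / q)" "x powr (1 / q) \<le> u k"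
      using lu[of "x powr (1 / q)"] x by auto
    have "(x powr (1 / q)) powr q = x" using x \<open>0 < q\<close> by (simp add: powr_powr)
    moreover have "l k powr q \<le> (x powr (1 / q)) powr q" "(x powr (1 / q)) powr q \<le> u k powr q"
      using k l(1)[of k] \<open>0 < q\<close> by (auto intro!: powr_mono2)
    ultimately show "x \<in> (\<Union>k. {l k powr q..u k powr q})" by auto
  next
    fix x :: real assume "x \<in> (\<Union>k. {l k powr q..u k powr q})"
    then obtain k where "l k powr q \<le> x" by auto
    then show "x \<in> {0<..}" using l(1)[of k] by (auto intro: less_le_trans[of _ "l k powr q"])
  qed
  have step: "(\<integral>\<^sup>+x\<in>{l k powr q..u k powr q}. h x * ennreal (1 / x) \<partial>lborel) =
      (\<integral>\<^sup>+y\<in>{l k..u k}. ennreal q * (h (y powr q) * ennreal (1 / y)) \<partial>lborel)" for k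
  proof -
    have "(\<integral>\<^sup>+x\<in>{l k powr q..u k powr q}. h x * ennreal (1 / x) \<partial>lborel) =
      (\<integral>\<^sup>+y\<in>{l k..u k}. (h (y powr q) * ennreal (1 / y powr q)) * ennreal (q * y powr (q - 1)) \<partial>lborel)"
    proof (rule nn_integral_substitution_aux[of "\<lambda>x. h x * ennreal (1 / x)"])
      show "((\<lambda>x. x powr q) has_real_derivative q * x powr (q - 1)) (at x)" if "x \<in> {l k..u k}" for x
        using that l(1)[of k] by (auto intro!: derivative_eq_intros)
      show "continuous_on {l k..u k} (\<lambda>x. q * x powr (q - 1))"
        using l(1)[of k] by (auto intro!: continuous_intros)
    qed (use l \<open>0 < q\<close> in auto)
    also have "\<dots> = (\<integral>\<^sup>+y\<in>{l k..u k}. ennreal q * (h (y powr q) * ennreal (1 / y)) \<partial>lborel)"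
    proof (rule nn_integral_cong)
      fix y :: real
      show "h (y powr q) * ennreal (1 / y powr q) * ennreal (q * y powr (q - 1)) * indicator {l k..u k} y =
        ennreal q * (h (y powr q) * ennreal (1 / y)) * indicator {l k..u k} y"
      proof (cases "y \<in> {l k..u k}")
        case True
        then have y: "0 < y" using l(1)[of k] by auto
        have "ennreal (1 / y powr q) * ennreal (q * y powr (q - 1)) =
          ennreal (1 / y powr q * (q * y powr (q - 1)))"
          using y \<open>0 < q\<close> by (intro ennreal_mult[symmetric]) auto
        also have "1 / y powr q * (q * y powr (q - 1)) = q * (1 / y)"
          using y by (simp add: powr_diff)
        also have "ennreal \<dots> = ennreal q * ennreal (1 / y)"
          using y \<open>0 < q\<close> by (intro ennreal_mult) auto
        finally show ?thesis by (simp add: mult_ac)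
      qed simp
    qed
    finally show ?thesis .
  qed
  have "(\<integral>\<^sup>+x\<in>{0<..}. h x * ennreal (1 / x) \<partial>lborel) =
      (SUP k. \<integral>\<^sup>+x\<in>{l k powr q..u k powr q}. h x * ennreal (1 / x) \<partial>lborel)"
    unfolding B2[symmetric]
  proof (rule nn_integral_SUP_incseq_sets)
    show "incseq (\<lambda>k. {l k powr q..u k powr q})"
      unfolding incseq_def using mono l \<open>0 < q\<close>
      by (auto intro: order_trans powr_mono2 less_imp_le)
         (meson l less_imp_le mono order_trans powr_mono2)+
  qed auto
  also have "\<dots> = (SUP k. \<integral>\<^sup>+y\<in>{l k..u k}. ennreal q * (h (y powr q) * ennreal (1 / y)) \<partial>lborel)"
    by (simp only: step)
  also have "\<dots> = (\<integral>\<^sup>+y\<in>{0<..}. ennreal q * (h (y powr q) * ennreal (1 / y)) \<partial>lborel)"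
    unfolding B1[symmetric]
  proof (rule nn_integral_SUP_incseq_sets[symmetric])
    show "incseq (\<lambda>k. {l k..u k})"
      unfolding incseq_def using mono by (auto intro: order_trans)
  qed auto
  also have "\<dots> = ennreal q * (\<integral>\<^sup>+y\<in>{0<..}. h (y powr q) * ennreal (1 / y) \<partial>lborel)"
    by (simp add: mult.assoc nn_integral_cmult)
  finally show ?thesis .
qed

interpretation lborel_product: product_sigma_finite "\<lambda>_. lborel :: real measure"
  by standard

text \<open>Induction on the index set: Tonelli splits off one coordinate, the one-dimensional rule
  contributes one factor \<open>q\<close>, and the induction hypothesis treats the rest. The
  indicators sit inside the product so that the weight factorizes over the coordinates and all
  integrals run over the whole space.\<close>

lemma nn_integral_PiM_powr_substitution:
  fixes g :: "('i \<Rightarrow> real) \<Rightarrow> ennreal" and q :: real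
  assumes "finite I" "0 < q" "g \<in> borel_measurable (Pi\<^sub>M I (\<lambda>_. lborel))"
  shows "(\<integral>\<^sup>+t. g t * (\<Prod>j\<in>I. ennreal (1 / t j) * indicator {0<..} (t j)) \<partial>Pi\<^sub>M I (\<lambda>_. lborel)) =
    ennreal (q ^ card I) *
    (\<integral>\<^sup>+s. g (\<lambda>j\<in>I. s j powr q) * (\<Prod>j\<in>I. ennreal (1 / s j) * indicator {0<..} (s j))
       \<partial>Pi\<^sub>M I (\<lambda>_. lborel))"
  using assms(1,3)
proof (induction I arbitrary: g rule: finite_induct)
  case empty
  show ?case by (simp add: PiM_empty nn_integral_count_space_finite)
next
  case (insert i I)
  note [measurable] = insert.prems
  define w :: "real \<Rightarrow> ennreal" where "w x = ennreal (1 / x) * indicator {0<..} x" for x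
  have [measurable]: "w \<in> borel_measurable borel" unfolding w_def by measurable
  define P where "P J t = (\<Prod>j\<in>J. w (t j))" for J :: "'i set" and t
  have [measurable]: "P J \<in> borel_measurable (Pi\<^sub>M J (\<lambda>_. lborel))" for J
    unfolding P_def by measurable
  \<comment> \<open>The restriction to \<open>J\<close> keeps \<open>r J s\<close> extensional,
    hence a point of the product space over \<open>J\<close>.\<close>
  define r where "r J s = (\<lambda>j\<in>J. s j powr q)" for J :: "'i set" and s
  have r_meas[measurable]: "r J \<in> measurable (Pi\<^sub>M J (\<lambda>_. lborel)) (Pi\<^sub>M J (\<lambda>_. lborel))" for J
    unfolding r_def by measurable
  have P_upd: "P (insert i I) (t(i := x)) = w x * P I t" for t x
  proof -
    have "(\<Prod>j\<in>I. w ((t(i := x)) j)) = (\<Prod>j\<in>I. w (t j))"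
      using insert.hyps by (intro prod.cong) auto
    then show ?thesis unfolding P_def using insert.hyps by simp
  qed
  have r_upd: "r (insert i I) (t(i := x)) = (r I t)(i := x powr q)" for t x
    unfolding r_def using insert.hyps by (auto simp: restrict_def)
  have one: "(\<integral>\<^sup>+x. h x * w x \<partial>lborel) = ennreal q * (\<integral>\<^sup>+x. h (x powr q) * w x \<partial>lborel)"
    if "h \<in> borel_measurable borel" for h
    using nn_integral_powr_substitution[OF that \<open>0 < q\<close>] by (simp add: w_def mult.assoc)
  have "(\<integral>\<^sup>+t. g t * P (insert i I) t \<partial>Pi\<^sub>M (insert i I) (\<lambda>_. lborel)) =
      (\<integral>\<^sup>+t. (\<integral>\<^sup>+x. g (t(i := x)) * P (insert i I) (t(i := x)) \<partial>lborel) \<partial>Pi\<^sub>M I (\<lambda>_. lborel))"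
    using insert.hyps by (intro lborel_product.product_nn_integral_insert) measurable
  also have "\<dots> = (\<integral>\<^sup>+t. ennreal q * (\<integral>\<^sup>+x. g (t(i := x powr q)) * w x \<partial>lborel) * P I t
      \<partial>Pi\<^sub>M I (\<lambda>_. lborel))"
  proof (rule nn_integral_cong)
    fix t :: "'i \<Rightarrow> real" assume t[measurable]: "t \<in> space (Pi\<^sub>M I (\<lambda>_. lborel))"
    have gm: "(\<lambda>x. g (t(i := x))) \<in> borel_measurable borel"
      using insert.hyps t by measurable
    have "(\<integral>\<^sup>+x. g (t(i := x)) * P (insert i I) (t(i := x)) \<partial>lborel) =
        (\<integral>\<^sup>+x. (g (t(i := x)) * w x) * P I t \<partial>lborel)"
      by (simp add: P_upd mult.assoc)
    also have "\<dots> = (\<integral>\<^sup>+x. g (t(i := x)) * w x \<partial>lborel) * P I t"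
      using gm by (intro nn_integral_multc) measurable
    finally show "(\<integral>\<^sup>+x. g (t(i := x)) * P (insert i I) (t(i := x)) \<partial>lborel) =
        ennreal q * (\<integral>\<^sup>+x. g (t(i := x powr q)) * w x \<partial>lborel) * P I t"
      using one[OF gm] by simp
  qed
  also have "\<dots> = ennreal (q ^ card I) * (\<integral>\<^sup>+t. ennreal q *
      (\<integral>\<^sup>+x. g ((r I t)(i := x powr q)) * w x \<partial>lborel) * P I t \<partial>Pi\<^sub>M I (\<lambda>_. lborel))"
  proof -
    \<comment> \<open>The induction hypothesis is used for the function left after integrating out
      coordinate \<open>i\<close>, not for \<open>g\<close> itself; this is why \<open>g\<close> is
      generalized in the induction.\<close>
    have "(\<lambda>t. ennreal q * (\<integral>\<^sup>+x. g (t(i := x powr q)) * w x \<partial>lborel))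
        \<in> borel_measurable (Pi\<^sub>M I (\<lambda>_. lborel))"
      using insert.hyps by measurable
    from insert.IH[OF this] show ?thesis unfolding w_def P_def r_def .
  qed
  also have "\<dots> = ennreal (q ^ card I) * (\<integral>\<^sup>+t. ennreal q *
      (\<integral>\<^sup>+x. g (r (insert i I) (t(i := x))) * P (insert i I) (t(i := x)) \<partial>lborel) \<partial>Pi\<^sub>M I (\<lambda>_. lborel))"
  proof (intro arg_cong[where f = "(*) _"] nn_integral_cong)
    fix t :: "'i \<Rightarrow> real" assume t: "t \<in> space (Pi\<^sub>M I (\<lambda>_. lborel))"
    have rt[measurable]: "r I t \<in> space (Pi\<^sub>M I (\<lambda>_. lborel))"
      using measurable_space[OF r_meas t] .
    have gm: "(\<lambda>x. g ((r I t)(i := x powr q))) \<in> borel_measurable borel"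
      using insert.hyps rt by measurable
    have "(\<integral>\<^sup>+x. g (r (insert i I) (t(i := x))) * P (insert i I) (t(i := x)) \<partial>lborel) =
      (\<integral>\<^sup>+x. (g ((r I t)(i := x powr q)) * w x) * P I t \<partial>lborel)"
      by (simp add: r_upd P_upd mult.assoc)
    also have "\<dots> = (\<integral>\<^sup>+x. g ((r I t)(i := x powr q)) * w x \<partial>lborel) * P I t"
      using gm by (intro nn_integral_multc) measurable
    finally show "ennreal q * (\<integral>\<^sup>+x. g ((r I t)(i := x powr q)) * w x \<partial>lborel) * P I t = ennreal q *
      (\<integral>\<^sup>+x. g (r (insert i I) (t(i := x))) * P (insert i I) (t(i := x)) \<partial>lborel)"
      by (simp add: mult.assoc)
  qed
  also have "\<dots> = ennreal (q ^ card I) * (ennreal q * (\<integral>\<^sup>+t.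
      (\<integral>\<^sup>+x. g (r (insert i I) (t(i := x))) * P (insert i I) (t(i := x)) \<partial>lborel) \<partial>Pi\<^sub>M I (\<lambda>_. lborel)))"
    using insert.hyps by (subst nn_integral_cmult) measurable
  also have "(\<integral>\<^sup>+t. (\<integral>\<^sup>+x. g (r (insert i I) (t(i := x))) * P (insert i I) (t(i := x)) \<partial>lborel)
      \<partial>Pi\<^sub>M I (\<lambda>_. lborel)) =
      (\<integral>\<^sup>+t. g (r (insert i I) t) * P (insert i I) t \<partial>Pi\<^sub>M (insert i I) (\<lambda>_. lborel))"
    using insert.hyps by (intro lborel_product.product_nn_integral_insert[symmetric]) measurable
  also have "ennreal (q ^ card I) * (ennreal q * \<dots>) = ennreal (q ^ card (insert i I)) * \<dots>"
    using insert.hyps \<open>0 < q\<close> by (simp add: ennreal_mult mult_ac)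
  finally show ?case unfolding P_def w_def r_def .
qed

section \<open>Powers of finite sums against sums of powers\<close>

text \<open>The sum is at most \<open>card I\<close> times its largest term, and the power of that
  term is one of the summands on the right. This covers the convex range \<open>1 \<le> q\<close>
  and the concave range \<open>q < 1\<close> together, at the price of a constant that is not
  sharp.\<close>

lemma powr_sum_le_card_powr_sum:
  fixes x :: "'i \<Rightarrow> real"
  assumes "finite I" "\<And>i. i \<in> I \<Longrightarrow> 0 \<le> x i" "0 < q"
  shows "(\<Sum>i\<in>I. x i) powr q \<le> real (card I) powr q * (\<Sum>i\<in>I. x i powr q)"
proof (cases "I = {}")
  case False
  define m where "m = Max (x ` I)"
  have "m \<in> x ` I" unfolding m_def using assms(1) False by (intro Max_in) auto
  then obtain k where k: "k \<in> I" "m = x k" by blast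
  have "(\<Sum>i\<in>I. x i) \<le> (\<Sum>i\<in>I. m)"
    using assms(1) by (intro sum_mono) (simp add: m_def)
  then have "(\<Sum>i\<in>I. x i) powr q \<le> (real (card I) * x k) powr q"
    using assms k by (intro powr_mono2) (auto intro: sum_nonneg)
  also have "\<dots> = real (card I) powr q * x k powr q"
    using assms(2) k by (simp add: powr_mult)
  also have "\<dots> \<le> real (card I) powr q * (\<Sum>i\<in>I. x i powr q)"
    using assms k by (intro mult_left_mono member_le_sum) auto
  finally show ?thesis .
qed simp

text \<open>Each term is at most the whole sum, and the power is monotone.\<close>

lemma sum_powr_le_card_powr_sum:
  fixes x :: "'i \<Rightarrow> real"
  assumes "finite I" "\<And>i. i \<in> I \<Longrightarrow> 0 \<le> x i" "0 < q"
  shows "(\<Sum>i\<in>I. x i powr q) \<le> real (card I) * (\<Sum>i\<in>I. x i) powr q"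
proof -
  have "(\<Sum>i\<in>I. x i powr q) \<le> (\<Sum>i\<in>I. (\<Sum>i\<in>I. x i) powr q)"
    using assms by (intro sum_mono powr_mono2 member_le_sum) auto
  then show ?thesis by simp
qed

section \<open>Powers of extended nonnegative reals\<close>

lemma ennreal_powr_mono:
  assumes "x \<le> y" "0 < \<alpha>"
  shows "ennreal_powr x \<alpha> \<le> ennreal_powr y \<alpha>"
  using assms
  by (auto simp: ennreal_powr_def top.extremum_unique less_top
      intro!: ennreal_leI powr_mono2 enn2real_mono)

lemma ennreal_powr_ennreal: "0 \<le> x \<Longrightarrow> ennreal_powr (ennreal x) \<alpha> = ennreal (x powr \<alpha>)"
  by (simp add: ennreal_powr_def)

lemma ennreal_powr_powr:
  "ennreal_powr (ennreal_powr x \<alpha>) \<beta> = ennreal_powr x (\<alpha> * \<beta>)"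
  by (auto simp: ennreal_powr_def powr_powr)

lemma ennreal_powr_cmult:
  assumes "0 < c"
  shows "ennreal_powr (ennreal c * x) \<alpha> = ennreal (c powr \<alpha>) * ennreal_powr x \<alpha>"
proof (cases x)
  case (real r)
  then show ?thesis using assms
    by (simp add: ennreal_powr_ennreal ennreal_mult[symmetric] powr_mult)
next
  case top
  then show ?thesis using assms
    by (simp add: ennreal_powr_def ennreal_mult_top)
qed

section \<open>The \<open>K\<close>-functional: elementary bounds and measurability\<close>

context
  fixes n :: nat and A :: "nat \<Rightarrow> ('v::comm_monoid_add) fspace" and a :: 'v
  assumes nonneg: "\<And>j x. j \<le> n \<Longrightarrow> x \<in> fst (A j) \<Longrightarrow> 0 \<le> snd (A j) x"
    and sum_space: "a \<in> sum_space n A"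
begin

lemma decompositions_nonempty: "decompositions n A a \<noteq> {}"
  using sum_space by (simp add: sum_space_def)

lemma weighted_sum_nonneg:
  assumes "\<And>j. j \<le> n \<Longrightarrow> 0 \<le> t j" "b \<in> decompositions n A a"
  shows "0 \<le> (\<Sum>j\<le>n. t j * snd (A j) (b j))"
  using assms nonneg by (auto intro!: sum_nonneg simp: decompositions_def)

text \<open>A real infimum obeys its order rules only over a nonempty set bounded below; with
  nonnegative weights the bound is 0.\<close>

lemma bdd_below_weighted_sums:
  assumes "\<And>j. j \<le> n \<Longrightarrow> 0 \<le> t j"
  shows "bdd_below ((\<lambda>b. \<Sum>j\<le>n. t j * snd (A j) (b j)) ` decompositions n A a)"
  using weighted_sum_nonneg[OF assms] by (intro bdd_belowI2[of _ 0])

lemma K_functional_le: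
  assumes "\<And>j. j \<le> n \<Longrightarrow> 0 \<le> t j" "b \<in> decompositions n A a"
  shows "K_functional n A t a \<le> (\<Sum>j\<le>n. t j * snd (A j) (b j))"
  unfolding K_functional_def using assms by (intro cINF_lower bdd_below_weighted_sums)

lemma le_K_functional:
  assumes "\<And>b. b \<in> decompositions n A a \<Longrightarrow> c \<le> (\<Sum>j\<le>n. t j * snd (A j) (b j))"
  shows "c \<le> K_functional n A t a"
  unfolding K_functional_def using assms by (intro cINF_greatest decompositions_nonempty)

lemma K_functional_nonneg:
  assumes "\<And>j. j \<le> n \<Longrightarrow> 0 \<le> t j"
  shows "0 \<le> K_functional n A t a"
  using weighted_sum_nonneg[OF assms] by (intro le_K_functional)

lemma K_functional_mono:
  assumes "\<And>j. j \<le> n \<Longrightarrow> 0 \<le> t j" "\<And>j. j \<le> n \<Longrightarrow> t j \<le> s j"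
  shows "K_functional n A t a \<le> K_functional n A s a"
proof (rule le_K_functional)
  fix b assume b: "b \<in> decompositions n A a"
  have "K_functional n A t a \<le> (\<Sum>j\<le>n. t j * snd (A j) (b j))"
    using assms b by (intro K_functional_le)
  also have "\<dots> \<le> (\<Sum>j\<le>n. s j * snd (A j) (b j))"
    using assms b nonneg by (intro sum_mono mult_right_mono) (auto simp: decompositions_def)
  finally show "K_functional n A t a \<le> (\<Sum>j\<le>n. s j * snd (A j) (b j))" .
qed

text \<open>\<open>K\<close> is increasing in the parameters and upper semicontinuous, so each sublevel set is the
  union of the boxes below its rational points.\<close>

lemma K_functional_measurable:
  "(\<lambda>t. K_functional n A (t(0 := 1)) a)
     \<in> borel_measurable (restrict_space (Pi\<^sub>M {1..n} (\<lambda>_. lborel)) (pos_orthant n))"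
  (is "?K \<in> borel_measurable (restrict_space ?M _)")
  unfolding borel_measurable_iff_less
proof
  fix c :: real
  define Q where "Q = {s \<in> PiE {1..n} (\<lambda>_. \<rat> \<inter> {0<..}). ?K s < c}"
  have "countable Q"
    unfolding Q_def
    by (rule countable_subset[OF _ countable_PiE[of "{1..n}" "\<lambda>_. \<rat> \<inter> {0<..}"]])
      (auto intro: countable_rat)
  have box: "PiE {1..n} (\<lambda>j. {0<..s j}) \<in> sets ?M" for s :: "nat \<Rightarrow> real"
    by (intro sets_PiM_I_finite) auto
  have "{t \<in> pos_orthant n. ?K t < c} = (\<Union>s\<in>Q. PiE {1..n} (\<lambda>j. {0<..s j}))"
  proof (intro equalityI subsetI)
    fix t assume "t \<in> {t \<in> pos_orthant n. ?K t < c}"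
    then have t: "t \<in> pos_orthant n" "?K t < c" by auto
    have t_nonneg: "0 \<le> (t(0 := 1)) j" if "j \<le> n" for j
      using t that by (cases "j = 0") (auto simp: PiE_iff less_imp_le)
    obtain b where b: "b \<in> decompositions n A a"
      and less: "(\<Sum>j\<le>n. (t(0 := 1)) j * snd (A j) (b j)) < c"
      using t(2) unfolding K_functional_def
      by (subst (asm) cINF_less_iff[OF decompositions_nonempty bdd_below_weighted_sums])
        (use t_nonneg in auto)
    \<comment> \<open>\<open>L h\<close> is the cost of the decomposition \<open>b\<close> when
      every weight is raised by \<open>h\<close>. By continuity it stays below \<open>c\<close> for
      some \<open>h > 0\<close>, which leaves room for a rational point strictly above
      \<open>t\<close>.\<close>
    define L where "L h = (\<Sum>j\<le>n. (t(0 := 1)) j * snd (A j) (b j)) + h * (\<Sum>j\<le>n. snd (A j) (b j))" for h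
    have "(L \<longlongrightarrow> L 0) (at_right 0)"
      unfolding L_def by (auto intro!: tendsto_eq_intros)
    moreover have "L 0 < c" using less by (simp add: L_def)
    ultimately have "eventually (\<lambda>h. L h < c) (at_right 0)" by (rule order_tendstoD)
    moreover have "eventually (\<lambda>h::real. 0 < h) (at_right 0)" by (rule eventually_at_right_less)
    ultimately have "eventually (\<lambda>h::real. L h < c \<and> 0 < h) (at_right 0)" by eventually_elim simp
    then obtain h where h: "L h < c" "0 < h"
      using eventually_happens'[OF trivial_limit_at_right_real] by blast
    have "\<exists>r\<in>\<rat>. t j < r \<and> r < t j + h" for j
      using Rats_dense_in_real[of "t j" "t j + h"] h(2) by auto
    then obtain r where r: "\<And>j. r j \<in> \<rat>" "\<And>j. t j < r j" "\<And>j. r j < t j + h"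
      by metis
    define s where "s = (\<lambda>j\<in>{1..n}. r j)"
    have s: "s \<in> PiE {1..n} (\<lambda>_. \<rat> \<inter> {0<..})"
      using r(1,2) t by (auto simp: s_def PiE_iff intro: less_trans)
    have s_nonneg: "0 \<le> (s(0 := 1)) j" if "j \<le> n" for j
      using s that by (cases "j = 0") (auto simp: PiE_iff less_imp_le)
    have "?K s \<le> (\<Sum>j\<le>n. (s(0 := 1)) j * snd (A j) (b j))"
      using b s_nonneg by (intro K_functional_le)
    \<comment> \<open>For \<open>j\<close> in \<open>{1..n}\<close> this is
      \<open>r j < t j + h\<close>; at index 0 it reads \<open>1 \<le> 1 + h\<close>.\<close>
    also have "\<dots> \<le> (\<Sum>j\<le>n. ((t(0 := 1)) j + h) * snd (A j) (b j))"
    proof (intro sum_mono mult_right_mono)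
      fix j assume "j \<in> {..n}"
      then show "(s(0 := 1)) j \<le> (t(0 := 1)) j + h" "0 \<le> snd (A j) (b j)"
        using r(3)[of j] h(2) b nonneg by (auto simp: s_def decompositions_def)
    qed
    also have "\<dots> = L h"
      by (simp add: L_def distrib_right sum.distrib sum_distrib_left)
    finally have "s \<in> Q" using s h by (simp add: Q_def)
    moreover have "t \<in> PiE {1..n} (\<lambda>j. {0<..s j})"
      using t r(2) by (auto simp: PiE_iff s_def less_imp_le)
    ultimately show "t \<in> (\<Union>s\<in>Q. PiE {1..n} (\<lambda>j. {0<..s j}))" by blast
  next
    fix t assume "t \<in> (\<Union>s\<in>Q. PiE {1..n} (\<lambda>j. {0<..s j}))"
    then obtain s where s: "s \<in> Q" "t \<in> PiE {1..n} (\<lambda>j. {0<..s j})" by blast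
    then have t: "t \<in> pos_orthant n" by (auto simp: PiE_iff)
    have "?K t \<le> ?K s"
      using s by (intro K_functional_mono) (auto simp: PiE_iff Ball_def less_imp_le)
    then show "t \<in> {t \<in> pos_orthant n. ?K t < c}" using s t by (auto simp: Q_def)
  qed
  also have "\<dots> \<in> sets ?M"
    using \<open>countable Q\<close> box by (intro sets.countable_UN'') auto
  finally have "{t \<in> pos_orthant n. ?K t < c} \<in> sets ?M" .
  moreover have "pos_orthant n \<inter> space ?M \<in> sets ?M"
    by (intro sets.Int sets_PiM_I_finite) auto
  moreover have "{w \<in> space (restrict_space ?M (pos_orthant n)). ?K w < c} =
      {t \<in> pos_orthant n. ?K t < c}"
    by (auto simp: space_restrict_space space_PiM PiE_iff)
  ultimately show "{w \<in> space (restrict_space ?M (pos_orthant n)). ?K w < c}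
      \<in> sets (restrict_space ?M (pos_orthant n))"
    by (auto simp: sets_restrict_space_iff)
qed

text \<open>Measurability is stated on the orthant only: each \<open>\<phi> j\<close> is continuous
  just on the open half-line, and the monotonicity of \<open>K_functional\<close> rests on
  nonnegative weights.\<close>

lemma K_quotient_measurable:
  assumes "\<And>j. j \<in> {1..n} \<Longrightarrow> continuous_on {0<..} (\<phi> j)"
  shows "K_quotient n \<phi> A a
    \<in> borel_measurable (restrict_space (Pi\<^sub>M {1..n} (\<lambda>_. lborel)) (pos_orthant n))"
  unfolding K_quotient_def
proof (intro borel_measurable_divide K_functional_measurable borel_measurable_prod)
  fix j assume j: "j \<in> {1..n}"
  have "(\<lambda>t. t j) \<in> measurable (restrict_space (Pi\<^sub>M {1..n} (\<lambda>_. lborel)) (pos_orthant n))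
      (restrict_space borel {0<..})"
    using j by (intro measurable_restrict_space3) (auto simp: PiE_iff)
  moreover have "\<phi> j \<in> borel_measurable (restrict_space borel {0<..})"
    using assms[OF j] by (rule borel_measurable_continuous_on_restrict)
  ultimately show "(\<lambda>t. \<phi> j (t j))
      \<in> borel_measurable (restrict_space (Pi\<^sub>M {1..n} (\<lambda>_. lborel)) (pos_orthant n))"
    by (rule measurable_compose)
qed

lemma K_quotient_nonneg:
  assumes "\<And>j x. j \<in> {1..n} \<Longrightarrow> 0 < x \<Longrightarrow> 0 < \<phi> j x" "t \<in> pos_orthant n"
  shows "0 \<le> K_quotient n \<phi> A a t"
  unfolding K_quotient_def using assms
  by (intro divide_nonneg_nonneg K_functional_nonneg prod_nonneg)
    (auto simp: PiE_iff Ball_def less_imp_le)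

end

section \<open>Powered tuples, and integrals over the positive orthant\<close>

lemma decompositions_space_power:
  "decompositions n (\<lambda>j. space_power q (A j)) a = decompositions n A a"
  by (simp add: decompositions_def space_power_def)

lemma sum_space_space_power: "sum_space n (\<lambda>j. space_power q (A j)) = sum_space n A"
  by (simp add: sum_space_def decompositions_space_power)

lemma ennreal_powr_one: "ennreal_powr x 1 = x"
  by (cases x) (auto simp: ennreal_powr_def)

lemma continuous_on_boyd_power:
  assumes "continuous_on {0<..} f" "\<And>x. 0 < x \<Longrightarrow> 0 < f x" "0 < q"
  shows "continuous_on {0<..} (boyd_power q f)"
proof -
  have "continuous_on {0<..} (\<lambda>t. f (t powr q))"
    by (rule continuous_on_compose2[OF assms(1)]) (auto intro!: continuous_intros)
  moreover have "f (t powr q) \<noteq> 0" if "0 < t" for t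
    using assms(2)[of "t powr q"] that by simp
  ultimately show ?thesis
    unfolding boyd_power_def by (intro continuous_on_powr) (auto intro!: continuous_intros)
qed

lemma pos_orthant_sets: "pos_orthant n \<in> sets (Pi\<^sub>M {1..n} (\<lambda>_. lborel))"
  by (intro sets_PiM_I_finite) auto

text \<open>The product rule in the shape that \<open>K_norm\<close> uses. The weight
  \<open>W\<close> is the reciprocal of the product of coordinates on the orthant and 0 elsewhere,
  while \<open>f\<close>, measurable on the orthant only, is cut off to a function \<open>g\<close>
  measurable on the whole space.\<close>

lemma nn_integral_pos_orthant_powr_substitution:
  fixes f :: "(nat \<Rightarrow> real) \<Rightarrow> real"
  assumes f: "f \<in> borel_measurable (restrict_space (Pi\<^sub>M {1..n} (\<lambda>_. lborel)) (pos_orthant n))"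
    and "0 < q"
  shows "(\<integral>\<^sup>+t\<in>pos_orthant n. ennreal (f t / (\<Prod>j=1..n. t j)) \<partial>Pi\<^sub>M {1..n} (\<lambda>_. lborel)) =
    ennreal (q ^ n) * (\<integral>\<^sup>+s\<in>pos_orthant n. ennreal (f (\<lambda>j\<in>{1..n}. s j powr q) / (\<Prod>j=1..n. s j))
       \<partial>Pi\<^sub>M {1..n} (\<lambda>_. lborel))"
proof -
  let ?M = "Pi\<^sub>M {1..n} (\<lambda>_. lborel :: real measure)"
  define W where "W t = (\<Prod>j=1..n. ennreal (1 / t j) * indicator {0<..} (t j))" for t :: "nat \<Rightarrow> real"
  define g where "g t = ennreal (f t) * indicator (pos_orthant n) t" for t
  have W: "W t = ennreal (1 / (\<Prod>j=1..n. t j))" if "t \<in> pos_orthant n" for t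
  proof -
    have "W t = (\<Prod>j=1..n. ennreal (1 / t j))"
      unfolding W_def using that by (intro prod.cong) (auto simp: PiE_iff)
    also have "\<dots> = ennreal (\<Prod>j=1..n. 1 / t j)"
      using that by (intro prod_ennreal) (auto simp: PiE_iff less_imp_le)
    finally show ?thesis by (simp add: prod_dividef)
  qed
  \<comment> \<open>Points of the space are extensional, so leaving the orthant means having a
    nonpositive coordinate, whose indicator annihilates the product.\<close>
  have W0: "W t = 0" if "t \<in> space ?M" "t \<notin> pos_orthant n" for t
  proof -
    have "\<exists>j\<in>{1..n}. \<not> 0 < t j"
      using that by (auto simp: space_PiM PiE_iff)
    then obtain j where "j \<in> {1..n}" "\<not> 0 < t j" by blast
    then show ?thesis
      unfolding W_def by (intro prod_zero bexI[of _ j]) auto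
  qed
  \<comment> \<open>\<open>c\<close> may have either sign: \<open>ennreal\<close> sends negative
    reals to 0, and multiplicativity asks only for the second factor to be nonnegative.\<close>
  have split: "ennreal (c / (\<Prod>j=1..n. t j)) * indicator (pos_orthant n) t =
      ennreal c * indicator (pos_orthant n) t * W t" if "t \<in> space ?M" for c t
  proof (cases "t \<in> pos_orthant n")
    case True
    then have "0 \<le> 1 / (\<Prod>j=1..n. t j)"
      by (auto intro!: prod_nonneg simp: PiE_iff less_imp_le)
    then have "ennreal (c * (1 / (\<Prod>j=1..n. t j))) = ennreal c * ennreal (1 / (\<Prod>j=1..n. t j))"
      by (rule ennreal_mult'')
    then show ?thesis using True W by simp
  qed simp
  have g: "g \<in> borel_measurable ?M"
    unfolding g_def using f pos_orthant_sets[of n]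
    by (subst borel_measurable_restrict_space_iff_ennreal[symmetric]) auto
  have "(\<integral>\<^sup>+t\<in>pos_orthant n. ennreal (f t / (\<Prod>j=1..n. t j)) \<partial>?M) = (\<integral>\<^sup>+t. g t * W t \<partial>?M)"
    unfolding g_def by (intro nn_integral_cong split)
  also have "\<dots> = ennreal (q ^ n) * (\<integral>\<^sup>+s. g (\<lambda>j\<in>{1..n}. s j powr q) * W s \<partial>?M)"
    using nn_integral_PiM_powr_substitution[OF _ \<open>0 < q\<close> g] by (simp add: W_def)
  also have "(\<integral>\<^sup>+s. g (\<lambda>j\<in>{1..n}. s j powr q) * W s \<partial>?M) =
      (\<integral>\<^sup>+s\<in>pos_orthant n. ennreal (f (\<lambda>j\<in>{1..n}. s j powr q) / (\<Prod>j=1..n. s j)) \<partial>?M)"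
  proof (rule nn_integral_cong)
    fix s assume s: "s \<in> space ?M"
    show "g (\<lambda>j\<in>{1..n}. s j powr q) * W s =
        ennreal (f (\<lambda>j\<in>{1..n}. s j powr q) / (\<Prod>j=1..n. s j)) * indicator (pos_orthant n) s"
    \<comment> \<open>Inside the orthant the image point is again inside, so the cut-off in
      \<open>g\<close> equals 1. Outside, \<open>W s = 0\<close> absorbs whatever
      \<open>powr\<close> yields at nonpositive arguments.\<close>
    proof (cases "s \<in> pos_orthant n")
      case True
      then have "(\<lambda>j\<in>{1..n}. s j powr q) \<in> pos_orthant n" by (auto simp: PiE_iff Ball_def)
      then show ?thesis using True unfolding split[OF s] by (simp add: g_def)
    qed (use W0[OF s] in simp)
  qed
  finally show ?thesis .
qed

lemma nn_integral_pos_orthant_le_cmult: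
  fixes f h :: "(nat \<Rightarrow> real) \<Rightarrow> real"
  assumes h: "h \<in> borel_measurable (restrict_space (Pi\<^sub>M {1..n} (\<lambda>_. lborel)) (pos_orthant n))"
    and le: "\<And>t. t \<in> pos_orthant n \<Longrightarrow> f t \<le> c * h t" and "0 \<le> c"
  shows "(\<integral>\<^sup>+t\<in>pos_orthant n. ennreal (f t / (\<Prod>j=1..n. t j)) \<partial>Pi\<^sub>M {1..n} (\<lambda>_. lborel)) \<le>
    ennreal c * (\<integral>\<^sup>+t\<in>pos_orthant n. ennreal (h t / (\<Prod>j=1..n. t j)) \<partial>Pi\<^sub>M {1..n} (\<lambda>_. lborel))"
proof -
  let ?M = "Pi\<^sub>M {1..n} (\<lambda>_. lborel :: real measure)"
  have prod: "(\<lambda>t. \<Prod>j=1..n. t j) \<in> borel_measurable (restrict_space ?M (pos_orthant n))"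
    by (rule measurable_restrict_space1) measurable
  have meas: "(\<lambda>t. ennreal (h t / (\<Prod>j=1..n. t j)) * indicator (pos_orthant n) t) \<in> borel_measurable ?M"
    using h prod pos_orthant_sets[of n]
    by (subst borel_measurable_restrict_space_iff_ennreal[symmetric]) auto
  have "(\<integral>\<^sup>+t\<in>pos_orthant n. ennreal (f t / (\<Prod>j=1..n. t j)) \<partial>?M) \<le>
    (\<integral>\<^sup>+t. ennreal c * (ennreal (h t / (\<Prod>j=1..n. t j)) * indicator (pos_orthant n) t) \<partial>?M)"
  proof (intro nn_integral_mono)
    fix t
    show "ennreal (f t / (\<Prod>j=1..n. t j)) * indicator (pos_orthant n) t \<le>
        ennreal c * (ennreal (h t / (\<Prod>j=1..n. t j)) * indicator (pos_orthant n) t)"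
    proof (cases "t \<in> pos_orthant n")
      case True
      then have "0 \<le> (\<Prod>j=1..n. t j)"
        by (auto intro!: prod_nonneg simp: PiE_iff less_imp_le)
      then have "f t / (\<Prod>j=1..n. t j) \<le> c * (h t / (\<Prod>j=1..n. t j))"
        using divide_right_mono[OF le[OF True]] by simp
      then have "ennreal (f t / (\<Prod>j=1..n. t j)) \<le> ennreal c * ennreal (h t / (\<Prod>j=1..n. t j))"
        using \<open>0 \<le> c\<close> by (metis ennreal_leI ennreal_mult')
      then show ?thesis using True by simp
    qed simp
  qed
  also have "\<dots> = ennreal c * (\<integral>\<^sup>+t\<in>pos_orthant n. ennreal (h t / (\<Prod>j=1..n. t j)) \<partial>?M)"
    using meas by (rule nn_integral_cmult)
  finally show ?thesis .
qed

section \<open>Comparison of \<open>K\<close>-functionals, quotients and norms with those of the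
  powered tuple\<close>

context
  fixes n :: nat and A :: "nat \<Rightarrow> ('v::comm_monoid_add) fspace" and a :: 'v and q :: real
  assumes nonneg: "\<And>j x. j \<le> n \<Longrightarrow> x \<in> fst (A j) \<Longrightarrow> 0 \<le> snd (A j) x"
    and sum_space: "a \<in> sum_space n A"
    and q: "0 < q"
begin

text \<open>This lemma and the next are the context assumptions for the powered tuple, so that the
  general facts on \<open>K_functional\<close> apply to it.\<close>

lemma nonneg_space_power:
  "j \<le> n \<Longrightarrow> x \<in> fst (space_power q (A j)) \<Longrightarrow> 0 \<le> snd (space_power q (A j)) x"
  by (simp add: space_power_def)

lemma sum_space_power: "a \<in> sum_space n (\<lambda>j. space_power q (A j))"
  using sum_space by (simp add: sum_space_space_power)

text \<open>For each decomposition the power of the sum is bounded by the sum of powers, and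
  \<open>powr\<close> distributes over the products of weight and norm. The constant is divided out
  first, so that the infimum over decompositions stands alone on the right.\<close>

lemma K_functional_powr_le:
  assumes "\<And>j. j \<le> n \<Longrightarrow> 0 \<le> s j"
  shows "K_functional n A s a powr q \<le>
    real (n + 1) powr q * K_functional n (\<lambda>j. space_power q (A j)) (\<lambda>j. s j powr q) a"
proof -
  have "K_functional n A s a powr q / real (n + 1) powr q \<le>
    K_functional n (\<lambda>j. space_power q (A j)) (\<lambda>j. s j powr q) a"
  proof (rule le_K_functional[OF nonneg_space_power sum_space_power])
    fix b assume "b \<in> decompositions n (\<lambda>j. space_power q (A j)) a"
    then have b: "b \<in> decompositions n A a" by (simp add: decompositions_space_power)
    have bn: "0 \<le> snd (A j) (b j)" if "j \<le> n" for j
      using b nonneg that by (auto simp: decompositions_def)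
    have "K_functional n A s a powr q \<le> (\<Sum>j\<le>n. s j * snd (A j) (b j)) powr q"
      using assms q b K_functional_nonneg[OF nonneg sum_space assms]
        K_functional_le[OF nonneg sum_space assms b]
      by (intro powr_mono2) auto
    also have "\<dots> \<le> real (card {..n}) powr q * (\<Sum>j\<le>n. (s j * snd (A j) (b j)) powr q)"
      using assms bn q by (intro powr_sum_le_card_powr_sum) auto
    also have "(\<Sum>j\<le>n. (s j * snd (A j) (b j)) powr q) =
        (\<Sum>j\<le>n. s j powr q * snd (space_power q (A j)) (b j))"
      using assms bn by (intro sum.cong) (auto simp: space_power_def powr_mult)
    finally show "K_functional n A s a powr q / real (n + 1) powr q \<le> \<dots>"
      by (simp add: divide_le_eq mult.commute)
  qed
  then show ?thesis by (simp add: divide_le_eq mult.commute)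
qed

text \<open>Here the infimum sits under the power. The bound for each decomposition is therefore
  turned by a \<open>q\<close>-th root into one on the plain weighted sum, and the power is restored
  after passing to the infimum.\<close>

lemma K_functional_space_power_le:
  assumes "\<And>j. j \<le> n \<Longrightarrow> 0 \<le> s j"
  shows "K_functional n (\<lambda>j. space_power q (A j)) (\<lambda>j. s j powr q) a \<le>
    real (n + 1) * K_functional n A s a powr q"
proof -
  define k where "k = K_functional n (\<lambda>j. space_power q (A j)) (\<lambda>j. s j powr q) a"
  have k: "0 \<le> k"
    unfolding k_def by (rule K_functional_nonneg[OF nonneg_space_power sum_space_power]) auto
  have "(k / real (n + 1)) powr (1 / q) \<le> K_functional n A s a"
  proof (rule le_K_functional[OF nonneg sum_space])
    fix b assume b: "b \<in> decompositions n A a"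
    have bn: "0 \<le> snd (A j) (b j)" if "j \<le> n" for j
      using b nonneg that by (auto simp: decompositions_def)
    have "k \<le> (\<Sum>j\<le>n. s j powr q * snd (space_power q (A j)) (b j))"
      unfolding k_def using b
      by (intro K_functional_le[OF nonneg_space_power sum_space_power])
        (auto simp: decompositions_space_power)
    also have "\<dots> = (\<Sum>j\<le>n. (s j * snd (A j) (b j)) powr q)"
      using assms bn by (intro sum.cong) (auto simp: space_power_def powr_mult)
    also have "\<dots> \<le> real (card {..n}) * (\<Sum>j\<le>n. s j * snd (A j) (b j)) powr q"
      using assms bn q by (intro sum_powr_le_card_powr_sum) auto
    finally have "k / real (n + 1) \<le> (\<Sum>j\<le>n. s j * snd (A j) (b j)) powr q"
      by (simp add: divide_le_eq mult.commute)
    then have "(k / real (n + 1)) powr (1 / q) \<le>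
        ((\<Sum>j\<le>n. s j * snd (A j) (b j)) powr q) powr (1 / q)"
      using q k by (intro powr_mono2) auto
    also have "\<dots> = (\<Sum>j\<le>n. s j * snd (A j) (b j))"
      using q weighted_sum_nonneg[OF nonneg sum_space assms b] by (simp add: powr_powr)
    finally show "(k / real (n + 1)) powr (1 / q) \<le> (\<Sum>j\<le>n. s j * snd (A j) (b j))" .
  qed
  then have "((k / real (n + 1)) powr (1 / q)) powr q \<le> K_functional n A s a powr q"
    using q by (intro powr_mono2) auto
  then have "k / real (n + 1) \<le> K_functional n A s a powr q"
    using q k by (simp add: powr_powr)
  then show ?thesis by (simp add: k_def divide_le_eq mult.commute)
qed

text \<open>The definition of \<open>boyd_power\<close> makes the denominators match exactly: the
  \<open>q\<close>-th power of the one at \<open>s\<close> is the one at \<open>t\<close>. Only the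
  \<open>K\<close>-functionals remain to be compared.\<close>

lemma K_quotient_space_power_bounds:
  assumes "\<And>j x. j \<in> {1..n} \<Longrightarrow> 0 < x \<Longrightarrow> 0 < \<phi> j x" and s: "s \<in> pos_orthant n"
  defines "t \<equiv> \<lambda>j\<in>{1..n}. s j powr q"
  shows "K_quotient n \<phi> (\<lambda>j. space_power q (A j)) a t \<le>
      real (n + 1) * K_quotient n (\<lambda>j. boyd_power q (\<phi> j)) A a s powr q" (is ?upper)
    and "K_quotient n (\<lambda>j. boyd_power q (\<phi> j)) A a s powr q \<le>
      real (n + 1) powr q * K_quotient n \<phi> (\<lambda>j. space_power q (A j)) a t" (is ?lower)
proof -
  let ?s = "s(0 := 1)" and ?p = "\<Prod>j=1..n. \<phi> j (s j powr q)"
  have s_pos: "0 < s j" if "j \<in> {1..n}" for j using s that by (auto simp: PiE_iff)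
  have s_nonneg: "0 \<le> ?s j" if "j \<le> n" for j
    using s_pos[of j] that by (cases "j = 0") auto
  have \<phi>_pos: "0 < \<phi> j (s j powr q)" if "j \<in> {1..n}" for j
    using assms(1)[OF that, of "s j powr q"] s_pos[OF that] by simp
  have p: "0 < ?p" using \<phi>_pos by (intro prod_pos) auto
  have "(\<Prod>j=1..n. boyd_power q (\<phi> j) (s j)) powr q = (\<Prod>j=1..n. boyd_power q (\<phi> j) (s j) powr q)"
    by (rule prod_powr_distrib)
  also have "\<dots> = ?p"
    using \<phi>_pos q by (intro prod.cong) (auto simp: boyd_power_def powr_powr less_imp_le)
  finally have H: "K_quotient n (\<lambda>j. boyd_power q (\<phi> j)) A a s powr q = K_functional n A ?s a powr q / ?p"
    unfolding K_quotient_def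
    using K_functional_nonneg[OF nonneg sum_space s_nonneg]
    by (simp add: powr_divide prod_nonneg boyd_power_def)
  \<comment> \<open>The leading weight fits the pattern because \<open>1 powr q = 1\<close>.\<close>
  have "K_functional n (\<lambda>j. space_power q (A j)) (t(0 := 1)) a =
      K_functional n (\<lambda>j. space_power q (A j)) (\<lambda>j. ?s j powr q) a"
    unfolding K_functional_def by (intro INF_cong refl sum.cong) (auto simp: t_def)
  moreover have "(\<Prod>j=1..n. \<phi> j (t j)) = ?p" by (intro prod.cong) (auto simp: t_def)
  ultimately have G: "K_quotient n \<phi> (\<lambda>j. space_power q (A j)) a t =
      K_functional n (\<lambda>j. space_power q (A j)) (\<lambda>j. ?s j powr q) a / ?p"
    by (simp add: K_quotient_def)
  show ?upper
    unfolding H G times_divide_eq_right using p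
    by (intro divide_right_mono K_functional_space_power_le s_nonneg less_imp_le[of 0])
  show ?lower
    unfolding H G times_divide_eq_right using p
    by (intro divide_right_mono K_functional_powr_le s_nonneg less_imp_le[of 0])
qed

text \<open>The pointwise bounds compare \<open>G (\<tau> s)\<close> with \<open>H s powr q\<close>;
  raised to the power \<open>r\<close> they involve \<open>H s powr (r * q)\<close>, which is where
  the product of the exponents comes from. In the constants \<open>q ^ n\<close> stems from the
  substitution and the powers of \<open>n + 1\<close> from the pointwise bounds; the outer exponent
  \<open>1 / r\<close> is that of the norm.\<close>

lemma K_norm_space_power_bounds_finite:
  assumes pos: "\<And>j x. j \<in> {1..n} \<Longrightarrow> 0 < x \<Longrightarrow> 0 < \<phi> j x"
    and cont: "\<And>j. j \<in> {1..n} \<Longrightarrow> continuous_on {0<..} (\<phi> j)" and r: "0 < r"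
  shows "K_norm n \<phi> (ennreal r) (\<lambda>j. space_power q (A j)) a \<le>
      ennreal ((q ^ n * real (n + 1) powr r) powr (1 / r)) *
      ennreal_powr (K_norm n (\<lambda>j. boyd_power q (\<phi> j)) (ennreal r * ennreal q) A a) q"
      (is "?N1 \<le> _ * ?P2")
    and "ennreal_powr (K_norm n (\<lambda>j. boyd_power q (\<phi> j)) (ennreal r * ennreal q) A a) q \<le>
      ennreal (((real (n + 1) powr q) powr r / q ^ n) powr (1 / r)) *
      K_norm n \<phi> (ennreal r) (\<lambda>j. space_power q (A j)) a"
proof -
  let ?M = "Pi\<^sub>M {1..n} (\<lambda>_. lborel :: real measure)"
  define G where "G = K_quotient n \<phi> (\<lambda>j. space_power q (A j)) a"
  define H where "H = K_quotient n (\<lambda>j. boyd_power q (\<phi> j)) A a"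
  define \<tau> where "\<tau> s = (\<lambda>j\<in>{1..n}. s j powr q)" for s :: "nat \<Rightarrow> real"
  define I1 where "I1 = (\<integral>\<^sup>+t\<in>pos_orthant n. ennreal (G t powr r / (\<Prod>j=1..n. t j)) \<partial>?M)"
  define I2 where "I2 = (\<integral>\<^sup>+s\<in>pos_orthant n. ennreal (H s powr (r * q) / (\<Prod>j=1..n. s j)) \<partial>?M)"
  define J where "J = (\<integral>\<^sup>+s\<in>pos_orthant n. ennreal (G (\<tau> s) powr r / (\<Prod>j=1..n. s j)) \<partial>?M)"
  have \<tau>: "\<tau> s \<in> pos_orthant n" if "s \<in> pos_orthant n" for s
    using that by (auto simp: \<tau>_def PiE_iff Ball_def)
  have G_meas: "G \<in> borel_measurable (restrict_space ?M (pos_orthant n))"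
    unfolding G_def using cont by (intro K_quotient_measurable[OF nonneg_space_power sum_space_power])
  have H_meas: "H \<in> borel_measurable (restrict_space ?M (pos_orthant n))"
    unfolding H_def using cont pos q
    by (intro K_quotient_measurable[OF nonneg sum_space] continuous_on_boyd_power)
  have G_nonneg: "0 \<le> G t" if "t \<in> pos_orthant n" for t
    unfolding G_def using pos that by (intro K_quotient_nonneg[OF nonneg_space_power sum_space_power])
  have upper: "G (\<tau> s) \<le> real (n + 1) * H s powr q" if "s \<in> pos_orthant n" for s
    unfolding G_def H_def \<tau>_def using pos that by (rule K_quotient_space_power_bounds)
  have lower: "H s powr q \<le> real (n + 1) powr q * G (\<tau> s)" if "s \<in> pos_orthant n" for s
    unfolding G_def H_def \<tau>_def using pos that by (rule K_quotient_space_power_bounds)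
  have I1: "I1 = ennreal (q ^ n) * J"
    unfolding I1_def J_def \<tau>_def
  proof (rule nn_integral_pos_orthant_powr_substitution)
    show "(\<lambda>t. G t powr r) \<in> borel_measurable (restrict_space ?M (pos_orthant n))"
      using G_meas by measurable
  qed (rule q)
  have J_upper: "J \<le> ennreal (real (n + 1) powr r) * I2"
    unfolding J_def I2_def
  proof (rule nn_integral_pos_orthant_le_cmult)
    show "(\<lambda>s. H s powr (r * q)) \<in> borel_measurable (restrict_space ?M (pos_orthant n))"
      using H_meas by measurable
    fix s assume s: "s \<in> pos_orthant n"
    have "G (\<tau> s) powr r \<le> (real (n + 1) * H s powr q) powr r"
      using upper[OF s] G_nonneg[OF \<tau>[OF s]] r by (intro powr_mono2) auto
    also have "\<dots> = real (n + 1) powr r * H s powr (r * q)"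
      by (simp add: powr_mult powr_powr mult.commute)
    finally show "G (\<tau> s) powr r \<le> real (n + 1) powr r * H s powr (r * q)" .
  qed simp
  have J_lower: "I2 \<le> ennreal ((real (n + 1) powr q) powr r) * J"
    unfolding J_def I2_def
  proof (rule nn_integral_pos_orthant_le_cmult)
    have "\<tau> \<in> measurable (restrict_space ?M (pos_orthant n)) (restrict_space ?M (pos_orthant n))"
      using \<tau> unfolding \<tau>_def by (intro measurable_restrict_space3) (auto, measurable)
    then have "(\<lambda>s. G (\<tau> s)) \<in> borel_measurable (restrict_space ?M (pos_orthant n))"
      using G_meas by (rule measurable_compose)
    then show "(\<lambda>s. G (\<tau> s) powr r) \<in> borel_measurable (restrict_space ?M (pos_orthant n))"
      by measurable
    fix s assume s: "s \<in> pos_orthant n"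
    have "H s powr (r * q) = (H s powr q) powr r" by (simp add: powr_powr mult.commute)
    also have "\<dots> \<le> (real (n + 1) powr q * G (\<tau> s)) powr r"
      using lower[OF s] r by (intro powr_mono2) auto
    also have "\<dots> = (real (n + 1) powr q) powr r * G (\<tau> s) powr r"
      using G_nonneg[OF \<tau>[OF s]] by (simp add: powr_mult)
    finally show "H s powr (r * q) \<le> (real (n + 1) powr q) powr r * G (\<tau> s) powr r" .
  qed simp
  have N1: "?N1 = ennreal_powr I1 (1 / r)"
    using r by (simp add: K_norm_def I1_def G_def)
  have rq: "ennreal r * ennreal q = ennreal (r * q)" using r q by (simp add: ennreal_mult)
  \<comment> \<open>The norm takes the root of order \<open>r * q\<close>; the outer power
    \<open>q\<close> leaves the exponent \<open>1 / r\<close>, the same as in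
    \<open>N1\<close>.\<close>
  have P2: "?P2 = ennreal_powr I2 (1 / r)"
    unfolding rq using r q by (simp add: K_norm_def I2_def H_def ennreal_powr_powr)
  have "I1 \<le> ennreal (q ^ n) * (ennreal (real (n + 1) powr r) * I2)"
    unfolding I1 by (intro mult_left_mono J_upper) simp
  also have "\<dots> = ennreal (q ^ n * real (n + 1) powr r) * I2"
    using q by (simp add: ennreal_mult mult.assoc)
  finally have "ennreal_powr I1 (1 / r) \<le> ennreal_powr (ennreal (q ^ n * real (n + 1) powr r) * I2) (1 / r)"
    using r by (intro ennreal_powr_mono) auto
  then show "?N1 \<le> ennreal ((q ^ n * real (n + 1) powr r) powr (1 / r)) * ?P2"
    unfolding N1 P2 using q by (simp add: ennreal_powr_cmult)
  \<comment> \<open>Solves \<open>I1 = q ^ n * J\<close> for \<open>J\<close> by a reciprocal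
    factor, which stays valid when \<open>J\<close> is infinite.\<close>
  have "J = ennreal (1 / q ^ n) * (ennreal (q ^ n) * J)"
    using q by (simp add: mult.assoc[symmetric] ennreal_mult[symmetric])
  then have "I2 \<le> ennreal ((real (n + 1) powr q) powr r) * (ennreal (1 / q ^ n) * I1)"
    using J_lower unfolding I1 by simp
  also have "\<dots> = ennreal ((real (n + 1) powr q) powr r / q ^ n) * I1"
    using q by (simp add: mult.assoc[symmetric] ennreal_mult[symmetric])
  finally have "ennreal_powr I2 (1 / r) \<le>
      ennreal_powr (ennreal ((real (n + 1) powr q) powr r / q ^ n) * I1) (1 / r)"
    using r by (intro ennreal_powr_mono) auto
  then show "?P2 \<le> ennreal (((real (n + 1) powr q) powr r / q ^ n) powr (1 / r)) * ?N1"
    unfolding N1 P2 using q by (simp add: ennreal_powr_cmult)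
qed

text \<open>The map \<open>\<tau>\<close> sends the orthant onto itself, so the pointwise bounds
  pass directly to the suprema.\<close>

lemma K_norm_space_power_bounds_infinite:
  assumes pos: "\<And>j x. j \<in> {1..n} \<Longrightarrow> 0 < x \<Longrightarrow> 0 < \<phi> j x"
  shows "K_norm n \<phi> \<infinity> (\<lambda>j. space_power q (A j)) a \<le>
      ennreal (real (n + 1)) * ennreal_powr (K_norm n (\<lambda>j. boyd_power q (\<phi> j)) \<infinity> A a) q"
      (is "?N1 \<le> _ * ennreal_powr ?N2 q")
    and "ennreal_powr (K_norm n (\<lambda>j. boyd_power q (\<phi> j)) \<infinity> A a) q \<le>
      ennreal (real (n + 1) powr q) * K_norm n \<phi> \<infinity> (\<lambda>j. space_power q (A j)) a"
proof -
  define G where "G = K_quotient n \<phi> (\<lambda>j. space_power q (A j)) a"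
  define H where "H = K_quotient n (\<lambda>j. boyd_power q (\<phi> j)) A a"
  define \<tau> where "\<tau> s = (\<lambda>j\<in>{1..n}. s j powr q)" for s :: "nat \<Rightarrow> real"
  have N1: "?N1 = (SUP t\<in>pos_orthant n. ennreal (G t))" by (simp add: K_norm_def G_def)
  have N2: "?N2 = (SUP s\<in>pos_orthant n. ennreal (H s))" by (simp add: K_norm_def H_def)
  have \<tau>: "\<tau> s \<in> pos_orthant n" if "s \<in> pos_orthant n" for s
    using that by (auto simp: \<tau>_def PiE_iff Ball_def)
  have H_nonneg: "0 \<le> H s" if "s \<in> pos_orthant n" for s
    unfolding H_def using that pos
    by (intro K_quotient_nonneg[OF nonneg sum_space]) (auto simp: boyd_power_def less_imp_neq[symmetric])
  have upper: "G (\<tau> s) \<le> real (n + 1) * H s powr q" if "s \<in> pos_orthant n" for s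
    unfolding G_def H_def \<tau>_def using pos that by (rule K_quotient_space_power_bounds)
  have lower: "H s powr q \<le> real (n + 1) powr q * G (\<tau> s)" if "s \<in> pos_orthant n" for s
    unfolding G_def H_def \<tau>_def using pos that by (rule K_quotient_space_power_bounds)
  show "?N1 \<le> ennreal (real (n + 1)) * ennreal_powr ?N2 q"
    unfolding N1
  proof (rule SUP_least)
    fix t assume t: "t \<in> pos_orthant n"
    define s where "s = (\<lambda>j\<in>{1..n}. t j powr (1 / q))"
    have s: "s \<in> pos_orthant n" using t by (auto simp: s_def PiE_iff Ball_def)
    have "\<tau> s = t"
    \<comment> \<open>Off \<open>{1..n}\<close> both functions are \<open>undefined\<close>, by
      restriction and by extensionality.\<close>
    proof
      fix j show "\<tau> s j = t j"
        using t q by (cases "j \<in> {1..n}") (auto simp: \<tau>_def s_def powr_powr PiE_iff extensional_def less_imp_le)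
    qed
    then have "ennreal (G t) \<le> ennreal (real (n + 1) * H s powr q)"
      using upper[OF s] by (auto intro!: ennreal_leI)
    also have "\<dots> = ennreal (real (n + 1)) * ennreal_powr (ennreal (H s)) q"
      using H_nonneg[OF s] by (simp add: ennreal_powr_ennreal ennreal_mult)
    also have "\<dots> \<le> ennreal (real (n + 1)) * ennreal_powr ?N2 q"
      unfolding N2 using s q by (intro mult_left_mono ennreal_powr_mono SUP_upper) auto
    finally show "ennreal (G t) \<le> ennreal (real (n + 1)) * ennreal_powr ?N2 q" .
  qed
  let ?B = "ennreal (real (n + 1) powr q) * ?N1"
  \<comment> \<open>The power stands outside the supremum, so the bound is proved for its
    \<open>q\<close>-th root, term by term, and raised to the power \<open>q\<close> at the
    end.\<close>
  have "?N2 \<le> ennreal_powr ?B (1 / q)"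
    unfolding N2
  proof (rule SUP_least)
    fix s assume s: "s \<in> pos_orthant n"
    have "ennreal (H s powr q) \<le> ennreal (real (n + 1) powr q * G (\<tau> s))"
      using lower[OF s] by (rule ennreal_leI)
    also have "\<dots> = ennreal (real (n + 1) powr q) * ennreal (G (\<tau> s))"
      by (simp add: ennreal_mult')
    also have "\<dots> \<le> ?B"
      unfolding N1 using \<tau>[OF s] by (intro mult_left_mono SUP_upper) auto
    finally have "ennreal_powr (ennreal (H s powr q)) (1 / q) \<le> ennreal_powr ?B (1 / q)"
      using q by (intro ennreal_powr_mono) auto
    then show "ennreal (H s) \<le> ennreal_powr ?B (1 / q)"
      using H_nonneg[OF s] q by (simp add: ennreal_powr_ennreal powr_powr)
  qed
  then have "ennreal_powr ?N2 q \<le> ennreal_powr (ennreal_powr ?B (1 / q)) q"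
    using q by (rule ennreal_powr_mono)
  then show "ennreal_powr ?N2 q \<le> ?B"
    using q by (simp add: ennreal_powr_powr ennreal_powr_one)
qed

end

section \<open>From two-sided norm bounds to equivalence of the spaces\<close>

text \<open>The bounds hold in the extended reals on the whole sum space, so each norm is finite
  where the other is, which identifies the two sets; there the bounds descend to real numbers. The
  lower constant is \<open>1 / C\<close>, since \<open>C\<close> bounds the first norm by the
  second. Exponents are arbitrary, so finite and infinite \<open>p\<close> are both served.\<close>

lemma fspace_equivalent_K_spaces:
  fixes B D :: "nat \<Rightarrow> ('v::comm_monoid_add) fspace"
  assumes "sum_space n B = sum_space n D" "0 < c" "0 < C" "0 < q"
    and le: "\<And>a. a \<in> sum_space n D \<Longrightarrow> K_norm n \<phi> p B a \<le> ennreal C * ennreal_powr (K_norm n \<psi> r D a) q"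
    and ge: "\<And>a. a \<in> sum_space n D \<Longrightarrow> ennreal_powr (K_norm n \<psi> r D a) q \<le> ennreal c * K_norm n \<phi> p B a"
  shows "fspace_equivalent (K_space n \<phi> p B) (space_power q (K_space n \<psi> r D))"
proof -
  have fin_iff: "K_norm n \<phi> p B a < \<infinity> \<longleftrightarrow> K_norm n \<psi> r D a < \<infinity>" if a: "a \<in> sum_space n D" for a
  proof
    assume "K_norm n \<phi> p B a < \<infinity>"
    then have "ennreal c * K_norm n \<phi> p B a < \<infinity>" by (simp add: ennreal_mult_less_top)
    with ge[OF a] have "ennreal_powr (K_norm n \<psi> r D a) q < \<infinity>" by (rule le_less_trans)
    then show "K_norm n \<psi> r D a < \<infinity>" by (auto simp: ennreal_powr_def less_top split: if_splits)
  next
    assume "K_norm n \<psi> r D a < \<infinity>"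
    then have "ennreal C * ennreal_powr (K_norm n \<psi> r D a) q < \<infinity>"
      by (auto simp: ennreal_powr_def ennreal_mult_less_top)
    with le[OF a] show "K_norm n \<phi> p B a < \<infinity>" by (rule le_less_trans)
  qed
  have bounds: "1 / C * enn2real (K_norm n \<phi> p B a) \<le> enn2real (K_norm n \<psi> r D a) powr q \<and>
      enn2real (K_norm n \<psi> r D a) powr q \<le> c * enn2real (K_norm n \<phi> p B a)"
    if a: "a \<in> sum_space n D" and fin: "K_norm n \<phi> p B a < \<infinity>" for a
  proof -
    obtain x where x: "K_norm n \<phi> p B a = ennreal x" "0 \<le> x"
      using fin by (cases "K_norm n \<phi> p B a") auto
    obtain y where y: "K_norm n \<psi> r D a = ennreal y" "0 \<le> y"
      using fin fin_iff[OF a] by (cases "K_norm n \<psi> r D a") auto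
    have "ennreal x \<le> ennreal (C * y powr q)" "ennreal (y powr q) \<le> ennreal (c * x)"
      using le[OF a] ge[OF a] \<open>0 < c\<close> \<open>0 < C\<close> by (simp_all add: x y ennreal_powr_ennreal ennreal_mult)
    then have "x \<le> C * y powr q" "y powr q \<le> c * x"
      using x(2) \<open>0 < c\<close> \<open>0 < C\<close> by (simp_all add: ennreal_le_iff)
    then show ?thesis using x y \<open>0 < C\<close> by (simp add: divide_le_eq mult.commute)
  qed
  show ?thesis
    unfolding fspace_equivalent_def
  proof
    show "fst (K_space n \<phi> p B) = fst (space_power q (K_space n \<psi> r D))"
      using fin_iff assms(1) by (auto simp: K_space_def space_power_def)
    have "0 < 1 / C" using \<open>0 < C\<close> by simp
    with \<open>0 < c\<close> bounds assms(1)
    show "\<exists>c>0. \<exists>C>0. \<forall>a\<in>fst (K_space n \<phi> p B).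
        c * snd (K_space n \<phi> p B) a \<le> snd (space_power q (K_space n \<psi> r D)) a \<and>
        snd (space_power q (K_space n \<psi> r D)) a \<le> C * snd (K_space n \<phi> p B) a"
      unfolding K_space_def space_power_def fst_conv snd_conv by blast
  qed
qed

theorem theorem6p1:
  fixes n :: nat and p :: ennreal and q :: real
    and \<phi> :: "nat \<Rightarrow> real \<Rightarrow> real"
    and A :: "nat \<Rightarrow> ('v::{topological_real_vector, t2_space}) fspace"
  assumes "n \<ge> 1" and "1 \<le> p" and "0 < q"
    and "\<And>j. j \<in> {1..n} \<Longrightarrow> \<phi> j \<in> boyd_functions"
    and "Min ((\<lambda>j. lower_boyd_index (\<phi> j)) ` {1..n}) > 0"
    and "Max ((\<lambda>j. upper_boyd_index (\<phi> j)) ` {1..n}) < 1"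
    and "\<And>j. j \<in> {0..n} \<Longrightarrow> banach_subspace (A j)"
  shows "fspace_equivalent
           (K_space n \<phi> p (\<lambda>j. space_power q (A j)))
           (space_power q (K_space n (\<lambda>j. boyd_power q (\<phi> j)) (p * ennreal q) A))"
proof -
  have nonneg: "0 \<le> snd (A j) x" if "j \<le> n" "x \<in> fst (A j)" for j x
    using assms(7)[of j] that by (auto simp: banach_subspace_def)
  have cont: "continuous_on {0<..} (\<phi> j)" if "j \<in> {1..n}" for j
    using assms(4)[OF that] by (simp add: boyd_functions_def)
  have pos: "0 < \<phi> j x" if "j \<in> {1..n}" "0 < x" for j x
    using assms(4)[OF that(1)] that(2) by (simp add: boyd_functions_def)
  show ?thesis
  proof (cases p)
    case (real r)
    \<comment> \<open>\<open>1 \<le> p\<close> excludes \<open>r = 0\<close>, so the root of order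
      \<open>r\<close> makes sense.\<close>
    then have "0 < r" using \<open>1 \<le> p\<close> by (cases "r = 0") auto
    show ?thesis
      unfolding real(2)
      using K_norm_space_power_bounds_finite[OF nonneg _ \<open>0 < q\<close> pos cont \<open>0 < r\<close>] \<open>0 < q\<close>
      by (intro fspace_equivalent_K_spaces[where C = "(q ^ n * real (n + 1) powr r) powr (1 / r)"
            and c = "((real (n + 1) powr q) powr r / q ^ n) powr (1 / r)"] sum_space_space_power)
        auto
  next
    case top
    \<comment> \<open>As \<open>q\<close> is positive, the product of exponents is infinite too, and
      both norms are suprema.\<close>
    then have "p = \<infinity>" "p * ennreal q = \<infinity>" using \<open>0 < q\<close> by (simp_all add: ennreal_top_mult)
    then show ?thesis
      using K_norm_space_power_bounds_infinite[OF nonneg _ \<open>0 < q\<close> pos] \<open>0 < q\<close>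
      by (intro fspace_equivalent_K_spaces[where C = "real (n + 1)" and c = "real (n + 1) powr q"]
            sum_space_space_power) auto
  qed
qed

end
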